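(* Let $K$ be a finite field with $q$ elements, let $v_1,\ldots,v_s\in\mathbb{N}^n$, let $X^*\subset K^s$ be the affine algebraic toric set parameterized by $y^{v_1},\ldots,y^{v_s}$, let $S=K[t_1,\ldots,t_s]$, and let $B=K[t_1,\ldots,t_s,y_1,\ldots,y_n]$ be a polynomial ring over $K$. Then $$ I(X^* )=\left(t_1-y^{v_1},\ldots,t_s-y^{v_s},\,y_1^{q-1}-1,\ldots,y_n^{q-1}-1\right)\cap S, $$ where the ideal on the right is an ideal of $B$, and $I(X^* )$ is a binomial ideal of $S$.
   Context: $\mathbb{N}$ contains $0$ and $K^*=K\setminus\{0\}$. For $v_i=(v_{i1},\ldots,v_{in})\in\mathbb{N}^n$, $y^{v_i}=y_1^{v_{i1}}\cdots y_n^{v_{in}}$. The affine algebraic toric set parameterized by $y^{v_1},\ldots,y^{v_s}$ is $$X^*=\{(x_1^{v_{11}}\cdots x_n^{v_{1n}},\ldots,x_1^{v_{s1}}\cdots x_n^{v_{sn}})\in K^s\mid x_1,\ldots,x_n\in K^*\}.$$ Its vanishing ideal $I(X^* )\subset S$ consists of all $f\in S$ that vanish at every point of $X^*$. A binomial of $S$ is a polynomial of the form $t^a-t^b$ with $a,b\in\mathbb{N}^s$; a binomial ideal is an ideal generated by binomials. *)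

theory Defs
  imports Complex_Main "HOL-Library.Cardinality" "HOL-Library.Poly_Mapping"
begin

(* Polynomials over 'k in the variables 'v: finitely supported maps from exponent vectors to
   coefficients. The instance in HOL-Library.Poly_Mapping multiplies by convolution, so this is
   the usual polynomial ring K[x_v : v in 'v]. *)
type_synonym ('v, 'k) mpoly = "('v \<Rightarrow>\<^sub>0 nat) \<Rightarrow>\<^sub>0 'k"

definition Const :: "'k \<Rightarrow> ('v, 'k::zero) mpoly" where
  "Const c = Poly_Mapping.single 0 c"

definition Var :: "'v \<Rightarrow> ('v, 'k::zero_neq_one) mpoly" where
  "Var i = Poly_Mapping.single (Poly_Mapping.single i 1) 1"

definition monomial :: "('v \<Rightarrow>\<^sub>0 nat) \<Rightarrow> ('v, 'k::zero_neq_one) mpoly" where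
  "monomial a = Poly_Mapping.single a 1"

(* For a ring homomorphism \<phi> from 'k to 'r, this is the homomorphism extending \<phi> that sends
   the variable i to x i. *)
definition poly_eval ::
    "('k::zero \<Rightarrow> 'r::comm_semiring_1) \<Rightarrow> ('v \<Rightarrow> 'r) \<Rightarrow> ('v, 'k) mpoly \<Rightarrow> 'r" where
  "poly_eval \<phi> x p =
     (\<Sum>m\<in>Poly_Mapping.keys p.
        \<phi> (Poly_Mapping.lookup p m) *
        (\<Prod>i\<in>Poly_Mapping.keys m. x i ^ Poly_Mapping.lookup m i))"

definition vanishing_ideal :: "('v \<Rightarrow> 'k::comm_semiring_1) set \<Rightarrow> ('v, 'k) mpoly set" where
  "vanishing_ideal X = {f. \<forall>P\<in>X. poly_eval (\<lambda>c. c) P f = 0}"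

(* The ideal generated by G: the submodule generated by G in the ring as a module over itself. *)
definition ideal_gen :: "'r::comm_ring_1 set \<Rightarrow> 'r set" where
  "ideal_gen G = module.span (*) G"

definition is_binomial :: "('v, 'k::comm_ring_1) mpoly \<Rightarrow> bool" where
  "is_binomial f \<longleftrightarrow> (\<exists>a b. f = monomial a - monomial b)"

definition binomial_ideal :: "('v, 'k::comm_ring_1) mpoly set \<Rightarrow> bool" where
  "binomial_ideal I \<longleftrightarrow> (\<exists>G. (\<forall>g\<in>G. is_binomial g) \<and> I = ideal_gen G)"

definition affine_toric_set :: "('s \<Rightarrow> 'n::finite \<Rightarrow> nat) \<Rightarrow> ('s \<Rightarrow> 'k::field) set" where
  "affine_toric_set v = {\<lambda>i. \<Prod>j\<in>UNIV. x j ^ v i j | x. \<forall>j. x j \<noteq> 0}"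

(* In B = K[t, y] the variables t_i are indexed by Inl i and the variables y_j by Inr j. *)

definition incl_S :: "('s, 'k::comm_semiring_1) mpoly \<Rightarrow> ('s + 'n, 'k) mpoly" where
  "incl_S = poly_eval Const (\<lambda>i. Var (Inl i))"

definition toric_gens :: "('s \<Rightarrow> 'n::finite \<Rightarrow> nat) \<Rightarrow> nat \<Rightarrow> ('s + 'n, 'k::comm_ring_1) mpoly set" where
  "toric_gens v q =
     {Var (Inl i) - (\<Prod>j\<in>UNIV. Var (Inr j) ^ v i j) | i. True} \<union>
     {Var (Inr j) ^ (q - 1) - 1 | j. True}"

end

theory Submission
  imports Defs "HOL-Computational_Algebra.Polynomial" "HOL-Library.FuncSet"
begin

text \<open>On a point of \<open>X\<^sup>*\<close> with parameter \<open>x\<close>, a monomial \<open>t\<^sup>m\<close> is a character of the group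
  \<open>(K\<^sup>*)\<^sup>n\<close>, and it depends only on the residue of the exponent vector \<open>\<Sum>\<^sub>i m\<^sub>i v\<^sub>i\<close> modulo
  \<open>q - 1\<close>. By orthogonality of characters, \<open>f\<close> vanishes on \<open>X\<^sup>*\<close> iff the coefficients of \<open>f\<close>
  add up to \<open>0\<close> over every residue class. Hence \<open>f\<close> is a linear combination of differences of
  monomials of equal residue. Modulo the ideal of \<open>B\<close>, each \<open>t\<^sup>m\<close> becomes a monomial in \<open>y\<close>
  given by its residue, so that \<open>f\<close> becomes \<open>0\<close>. Conversely, the generators of that ideal vanish
  at the points \<open>(x\<^bsup>v\<^esup>, x)\<close>.\<close>

declare One_nat_def [simp del]

section \<open>Finite fields\<close>

lemma card_Compl_zero: "card (- {0::'k::{zero,finite}}) = CARD('k) - 1"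
  by (simp add: Compl_eq_Diff_UNIV card_Diff_singleton)

text \<open>Multiplication by \<open>x\<close> permutes the nonzero elements, so their product
  \<open>P\<close>, itself nonzero, satisfies \<open>P = x ^ (q - 1) * P\<close>.\<close>

lemma finite_field_power_card_minus_1:
  fixes x :: "'k::{field,finite}"
  assumes "x \<noteq> 0"
  shows "x ^ (CARD('k) - 1) = 1"
proof -
  let ?U = "- {0::'k}"
  have "(\<Prod>y\<in>?U. y) = (\<Prod>y\<in>?U. x * y)"
    by (rule prod.reindex_bij_witness[of _ "\<lambda>y. x * y" "\<lambda>y. y / x"]) (use assms in auto)
  also have "\<dots> = x ^ card ?U * (\<Prod>y\<in>?U. y)"
    by (simp add: prod.distrib)
  finally have "x ^ card ?U = 1"
    by simp
  then show ?thesis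
    by (simp add: card_Compl_zero)
qed

text \<open>Translation by 1 permutes the field, so adding \<open>q\<close> copies of 1 to the sum
  of all elements does not change it.\<close>

lemma finite_field_of_nat_card: "of_nat CARD('k) = (0::'k::{field,finite})"
proof -
  have "(\<Sum>y\<in>UNIV. y) = (\<Sum>y\<in>UNIV. y + (1::'k))"
    by (rule sum.reindex_bij_witness[of _ "\<lambda>y. y + 1" "\<lambda>y. y - 1"]) auto
  then show ?thesis
    by (simp add: sum.distrib)
qed

lemma finite_field_card_gt_1: "CARD('k::{field,finite}) > 1"
  using card_mono[of UNIV "{0, 1::'k}"] by simp

lemma finite_field_power_mod:
  fixes x :: "'k::{field,finite}"
  assumes "x \<noteq> 0"
  shows "x ^ (e mod (CARD('k) - 1)) = x ^ e"
proof -
  have "x ^ e = x ^ ((CARD('k) - 1) * (e div (CARD('k) - 1)) + e mod (CARD('k) - 1))"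
    by simp
  also have "\<dots> = x ^ (e mod (CARD('k) - 1))"
    using finite_field_power_card_minus_1[OF assms] by (simp only: power_add power_mult) simp
  finally show ?thesis
    by simp
qed

text \<open>Orthogonality for the character \<open>x ^ e\<close> of the multiplicative group. In the
  trivial case the sum is \<open>q - 1\<close>, which equals -1 because \<open>q = 0\<close> in the
  field.\<close>

lemma finite_field_sum_powers:
  "(\<Sum>x\<in>- {0}. x ^ e) = (if CARD('k) - 1 dvd e then -1 else (0::'k::{field,finite}))"
proof (cases "CARD('k) - 1 dvd e")
  case True
  then obtain d where d: "e = (CARD('k) - 1) * d"
    by auto
  have "(\<Sum>x\<in>- {0}. x ^ e) = (\<Sum>x\<in>- {0::'k}. (1::'k))"
    by (intro sum.cong refl) (simp add: d power_mult finite_field_power_card_minus_1)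
  also have "\<dots> = of_nat (CARD('k) - 1)"
    by (simp add: card_Compl_zero)
  also have "\<dots> = -1"
    using finite_field_card_gt_1[where 'k='k]
    by (simp add: of_nat_diff finite_field_of_nat_card)
  finally show ?thesis
    using True by simp
next
  case False
  define r where "r = e mod (CARD('k) - 1)"
  have r: "0 < r" "r < CARD('k) - 1"
    using False finite_field_card_gt_1[where 'k='k] by (auto simp: r_def dvd_eq_mod_eq_0)
  \<comment> \<open>A nonzero polynomial of degree at most \<open>r < q - 1\<close> cannot vanish at
    all \<open>q - 1\<close> nonzero elements; a nonzero non-root of \<open>p\<close> is an
    \<open>a\<close> with \<open>a ^ r \<noteq> 1\<close>.\<close>
  define p where "p = monom (1::'k) r - 1"
  have "coeff p r = 1"
    using r by (simp add: p_def)
  then have "p \<noteq> 0"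
    by auto
  moreover have "degree p \<le> r"
    unfolding p_def by (intro degree_diff_le) (auto simp: degree_monom_le)
  ultimately have "card {x. poly p x = 0} < card (- {0::'k})"
    using card_poly_roots_bound[of p] r by (simp add: card_Compl_zero)
  then have "\<not> - {0} \<subseteq> {x. poly p x = 0}"
    by (meson card_mono finite leD)
  then obtain a where "a \<noteq> 0" "poly p a \<noteq> 0"
    by auto
  then have a: "a \<noteq> 0" "a ^ r \<noteq> 1"
    by (simp_all add: p_def poly_monom)
  \<comment> \<open>Rescaling by \<open>a\<close> permutes the summation range and multiplies the
    sum by \<open>a ^ r \<noteq> 1\<close>, which forces it to be 0.\<close>
  have "(\<Sum>x\<in>- {0}. x ^ e) = (\<Sum>x\<in>- {0}. (a * x) ^ e)"
    by (rule sum.reindex_bij_witness[of _ "\<lambda>y. a * y" "\<lambda>y. y / a"]) (use a in auto)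
  also have "\<dots> = a ^ r * (\<Sum>x\<in>- {0}. x ^ e)"
    using finite_field_power_mod[OF a(1), of e] by (simp add: power_mult_distrib sum_distrib_left r_def)
  finally show ?thesis
    using a False by simp
qed

section \<open>Evaluation of polynomials\<close>

lemma poly_mapping_sum_single:
  "(\<Sum>m\<in>Poly_Mapping.keys p. Poly_Mapping.single m (Poly_Mapping.lookup p m)) = p"
  by (rule poly_mapping_eqI)
    (simp add: lookup_sum lookup_single when_def in_keys_iff)

text \<open>Variables outside the support of \<open>m\<close> contribute \<open>x i ^ 0 = 1\<close>.
  An index set independent of \<open>m\<close> lets products for different monomials be multiplied
  factor by factor.\<close>

lemma poly_eval_prod_UNIV:
  fixes p :: "('v::finite, 'k::zero) mpoly"
  shows "poly_eval \<phi> x p = (\<Sum>m\<in>Poly_Mapping.keys p.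
    \<phi> (Poly_Mapping.lookup p m) * (\<Prod>i\<in>UNIV. x i ^ Poly_Mapping.lookup m i))"
  unfolding poly_eval_def
  by (intro sum.cong refl arg_cong2[where f = "(*)"] prod.mono_neutral_left)
    (auto simp: in_keys_iff)

lemma poly_eval_0 [simp]: "poly_eval \<phi> x 0 = 0"
  by (simp add: poly_eval_def)

lemma poly_eval_single:
  fixes x :: "'v::finite \<Rightarrow> 'k::comm_semiring_1"
  shows "poly_eval (\<lambda>c. c) x (Poly_Mapping.single m c) =
    c * (\<Prod>i\<in>UNIV. x i ^ Poly_Mapping.lookup m i)"
  by (cases "c = 0") (simp_all add: poly_eval_prod_UNIV)

lemma poly_eval_add:
  "poly_eval (\<lambda>c. c) x (p + q) = poly_eval (\<lambda>c. c) x p + poly_eval (\<lambda>c. c) x q"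
  unfolding poly_eval_def
  by (rule setsum_keys_plus_distrib) (auto simp: distrib_right)

lemma poly_eval_sum:
  "poly_eval (\<lambda>c. c) x (sum f A) = (\<Sum>a\<in>A. poly_eval (\<lambda>c. c) x (f a))"
  by (induction A rule: infinite_finite_induct) (simp_all add: poly_eval_add)

lemma poly_eval_diff:
  fixes x :: "'v \<Rightarrow> 'k::comm_ring_1"
  shows "poly_eval (\<lambda>c. c) x (p - q) = poly_eval (\<lambda>c. c) x p - poly_eval (\<lambda>c. c) x q"
  using poly_eval_add[of x "p - q" q] by (simp add: algebra_simps)

lemma poly_eval_mult:
  fixes x :: "'v::finite \<Rightarrow> 'k::comm_semiring_1"
  shows "poly_eval (\<lambda>c. c) x (p * q) = poly_eval (\<lambda>c. c) x p * poly_eval (\<lambda>c. c) x q"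
proof -
  let ?S = "\<lambda>p m. Poly_Mapping.single m (Poly_Mapping.lookup p m)"
  have "poly_eval (\<lambda>c. c) x (p * q) =
      poly_eval (\<lambda>c. c) x ((\<Sum>m\<in>Poly_Mapping.keys p. ?S p m) * (\<Sum>m\<in>Poly_Mapping.keys q. ?S q m))"
    by (simp add: poly_mapping_sum_single)
  also have "\<dots> = (\<Sum>m\<in>Poly_Mapping.keys p. \<Sum>m'\<in>Poly_Mapping.keys q.
      poly_eval (\<lambda>c. c) x (?S p m) * poly_eval (\<lambda>c. c) x (?S q m'))"
    by (simp add: sum_product poly_eval_sum mult_single poly_eval_single lookup_add power_add
        prod.distrib mult_ac)
  also have "\<dots> = poly_eval (\<lambda>c. c) x (\<Sum>m\<in>Poly_Mapping.keys p. ?S p m) *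
      poly_eval (\<lambda>c. c) x (\<Sum>m\<in>Poly_Mapping.keys q. ?S q m)"
    by (simp only: poly_eval_sum sum_product)
  finally show ?thesis
    by (simp only: poly_mapping_sum_single)
qed

lemma poly_eval_1 [simp]:
  fixes x :: "'v::finite \<Rightarrow> 'k::comm_semiring_1"
  shows "poly_eval (\<lambda>c. c) x 1 = 1"
  using poly_eval_single[of x 0 1] by simp

lemma poly_eval_Const [simp]:
  fixes x :: "'v::finite \<Rightarrow> 'k::comm_semiring_1"
  shows "poly_eval (\<lambda>c. c) x (Const c) = c"
  by (simp add: Const_def poly_eval_single)

lemma poly_eval_Var [simp]:
  fixes x :: "'v::finite \<Rightarrow> 'k::comm_semiring_1"
  shows "poly_eval (\<lambda>c. c) x (Var i) = x i"
  by (simp add: Var_def poly_eval_def)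

lemma poly_eval_power:
  fixes x :: "'v::finite \<Rightarrow> 'k::comm_semiring_1"
  shows "poly_eval (\<lambda>c. c) x (p ^ n) = poly_eval (\<lambda>c. c) x p ^ n"
  by (induction n) (simp_all add: poly_eval_mult)

lemma poly_eval_prod:
  fixes x :: "'v::finite \<Rightarrow> 'k::comm_semiring_1"
  shows "poly_eval (\<lambda>c. c) x (prod f A) = (\<Prod>a\<in>A. poly_eval (\<lambda>c. c) x (f a))"
  by (induction A rule: infinite_finite_induct) (simp_all add: poly_eval_mult)

lemma poly_eval_incl_S:
  fixes x :: "'s::finite + 'n::finite \<Rightarrow> 'k::comm_semiring_1"
  shows "poly_eval (\<lambda>c. c) x (incl_S f) = poly_eval (\<lambda>c. c) (\<lambda>i. x (Inl i)) f"
  unfolding incl_S_def poly_eval_prod_UNIV[of Const]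
  by (simp add: poly_eval_sum poly_eval_mult poly_eval_prod poly_eval_power)
    (simp add: poly_eval_prod_UNIV)

section \<open>Ideals\<close>

interpretation ring_module: module "(*) :: 'r::comm_ring_1 \<Rightarrow> 'r \<Rightarrow> 'r"
  by unfold_locales (simp_all add: algebra_simps)

lemma ideal_gen_base: "g \<in> G \<Longrightarrow> g \<in> ideal_gen G"
  unfolding ideal_gen_def by (rule ring_module.span_base)

lemma ideal_gen_mult: "g \<in> ideal_gen G \<Longrightarrow> c * g \<in> ideal_gen G"
  unfolding ideal_gen_def by (rule ring_module.span_scale)

lemma ideal_gen_zero: "0 \<in> ideal_gen G"
  unfolding ideal_gen_def by (rule ring_module.span_zero)

lemma ideal_gen_add: "f \<in> ideal_gen G \<Longrightarrow> g \<in> ideal_gen G \<Longrightarrow> f + g \<in> ideal_gen G"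
  unfolding ideal_gen_def by (rule ring_module.span_add)

lemma ideal_gen_sum: "(\<And>a. a \<in> A \<Longrightarrow> f a \<in> ideal_gen G) \<Longrightarrow> sum f A \<in> ideal_gen G"
  unfolding ideal_gen_def by (rule ring_module.span_sum)

text \<open>Membership of \<open>a - b\<close> serves as congruence modulo the ideal; products,
  powers and exponent reduction below all rest on this compatibility.\<close>

lemma ideal_gen_cong_mult:
  assumes "a - b \<in> ideal_gen G" "c - d \<in> ideal_gen G"
  shows "a * c - b * d \<in> ideal_gen G"
proof -
  have "a * c - b * d = c * (a - b) + b * (c - d)"
    by (simp add: algebra_simps)
  then show ?thesis
    using assms by (auto intro: ideal_gen_add ideal_gen_mult)
qed

lemma ideal_gen_cong_power:
  "a - b \<in> ideal_gen G \<Longrightarrow> a ^ n - b ^ n \<in> ideal_gen G"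
  by (induction n) (auto intro: ideal_gen_cong_mult ideal_gen_zero)

lemma ideal_gen_cong_prod:
  "(\<And>i. i \<in> A \<Longrightarrow> f i - g i \<in> ideal_gen G) \<Longrightarrow> prod f A - prod g A \<in> ideal_gen G"
  by (induction A rule: infinite_finite_induct) (auto intro: ideal_gen_cong_mult ideal_gen_zero)

lemma ideal_gen_cong_power_mod:
  assumes "a ^ k - 1 \<in> ideal_gen G"
  shows "a ^ e - a ^ (e mod k) \<in> ideal_gen G"
proof -
  have "(a ^ k) ^ (e div k) * a ^ (e mod k) - 1 ^ (e div k) * a ^ (e mod k) \<in> ideal_gen G"
    by (intro ideal_gen_cong_mult ideal_gen_cong_power assms) (simp add: ideal_gen_zero)
  then show ?thesis
    by (simp flip: power_mult power_add)
qed

text \<open>A vanishing ideal is closed under sums and multiples, so it suffices to test the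
  generators.\<close>

lemma ideal_gen_subset_vanishing_ideal:
  fixes X :: "('v::finite \<Rightarrow> 'k::comm_ring_1) set"
  assumes "G \<subseteq> vanishing_ideal X"
  shows "ideal_gen G \<subseteq> vanishing_ideal X"
  unfolding ideal_gen_def using assms
  by (rule ring_module.span_minimal)
    (auto simp: ring_module.subspace_def vanishing_ideal_def poly_eval_add poly_eval_mult)

section \<open>Residue classes of exponents\<close>

definition residue :: "('s::finite \<Rightarrow> 'n \<Rightarrow> nat) \<Rightarrow> nat \<Rightarrow> ('s \<Rightarrow>\<^sub>0 nat) \<Rightarrow> 'n \<Rightarrow> nat" where
  "residue v k m = (\<lambda>j. (\<Sum>i\<in>UNIV. v i j * Poly_Mapping.lookup m i) mod k)"

text \<open>The semiring is arbitrary because the identity serves both for points over the field and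
  for the variables \<open>y_j\<close> of \<open>B\<close>.\<close>

lemma prod_parametrization_power:
  fixes x :: "'n::finite \<Rightarrow> 'r::comm_semiring_1"
  shows "(\<Prod>i\<in>UNIV. (\<Prod>j\<in>UNIV. x j ^ v i j) ^ m i) =
    (\<Prod>j\<in>UNIV. x j ^ (\<Sum>i\<in>(UNIV::'s::finite set). v i j * m i))"
proof -
  have "(\<Prod>i\<in>UNIV. (\<Prod>j\<in>UNIV. x j ^ v i j) ^ m i) =
      (\<Prod>i\<in>(UNIV::'s set). \<Prod>j\<in>UNIV. x j ^ (v i j * m i))"
    by (simp add: prod_power_distrib power_mult)
  also have "\<dots> = (\<Prod>j\<in>UNIV. \<Prod>i\<in>UNIV. x j ^ (v i j * m i))"
    by (rule prod.swap)
  finally show ?thesis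
    by (simp add: power_sum)
qed

lemma poly_eval_single_parametrization:
  fixes v :: "'s::finite \<Rightarrow> 'n::finite \<Rightarrow> nat" and x :: "'n \<Rightarrow> 'k::{field,finite}"
  assumes "\<And>j. x j \<noteq> 0"
  shows "poly_eval (\<lambda>c. c) (\<lambda>i. \<Prod>j\<in>UNIV. x j ^ v i j) (Poly_Mapping.single m c) =
    c * (\<Prod>j\<in>UNIV. x j ^ residue v (CARD('k) - 1) m j)"
  using assms
  by (simp add: poly_eval_single prod_parametrization_power residue_def finite_field_power_mod)

lemma poly_eval_parametrization:
  fixes v :: "'s::finite \<Rightarrow> 'n::finite \<Rightarrow> nat" and x :: "'n \<Rightarrow> 'k::{field,finite}"
  assumes "\<And>j. x j \<noteq> 0"
  shows "poly_eval (\<lambda>c. c) (\<lambda>i. \<Prod>j\<in>UNIV. x j ^ v i j) f = (\<Sum>m\<in>Poly_Mapping.keys f.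
    Poly_Mapping.lookup f m * (\<Prod>j\<in>UNIV. x j ^ residue v (CARD('k) - 1) m j))"
proof -
  let ?e = "poly_eval (\<lambda>c. c) (\<lambda>i. \<Prod>j\<in>UNIV. x j ^ v i j)"
  have "?e f = ?e (\<Sum>m\<in>Poly_Mapping.keys f. Poly_Mapping.single m (Poly_Mapping.lookup f m))"
    by (simp only: poly_mapping_sum_single)
  then show ?thesis
    by (simp only: poly_eval_sum poly_eval_single_parametrization[OF assms])
qed

text \<open>Two numbers below \<open>k\<close> agree iff \<open>k\<close> divides their difference;
  \<open>k - c j\<close> stands for \<open>- c j\<close> among the naturals. This matches the
  divisibility condition in \<open>finite_field_sum_powers\<close>.\<close>

lemma residue_eq_iff:
  assumes "\<And>j. c j < k"
  shows "residue v k m = c \<longleftrightarrow>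
    (\<forall>j. k dvd residue v k m j + (k - c j))"
proof -
  have "residue v k m j = c j \<longleftrightarrow> k dvd residue v k m j + (k - c j)" for j
  proof -
    let ?r = "residue v k m j"
    have r: "?r < k"
      using assms[of j] by (simp add: residue_def)
    have "k dvd ?r + (k - c j) \<longleftrightarrow> (int k) dvd int ?r - int (c j) + int k"
      using assms[of j] by (simp flip: int_dvd_int_iff add: algebra_simps of_nat_diff)
    also have "\<dots> \<longleftrightarrow> int k dvd int ?r - int (c j)"
      by simp
    also have "\<dots> \<longleftrightarrow> int ?r mod int k = int (c j) mod int k"
      by (simp add: mod_eq_dvd_iff)
    finally show ?thesis
      using r assms[of j] by simp
  qed
  then show ?thesis
    by (auto simp: fun_eq_iff)
qed

text \<open>The exponent \<open>q - 1 - c\<^sub>j\<close> below plays the role of the inverse character of residue \<open>c\<close>.\<close>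

lemma vanishing_class_sum:
  fixes v :: "'s::finite \<Rightarrow> 'n::finite \<Rightarrow> nat" and f :: "('s, 'k::{field,finite}) mpoly"
  assumes f: "f \<in> vanishing_ideal (affine_toric_set v)"
  shows "(\<Sum>m | m \<in> Poly_Mapping.keys f \<and> residue v (CARD('k) - 1) m = c. Poly_Mapping.lookup f m) = 0"
proof (cases "\<forall>j. c j < CARD('k) - 1")
  case False
  \<comment> \<open>Residues have all entries below \<open>q - 1\<close>, so the class of such a
    \<open>c\<close> is empty.\<close>
  have "residue v (CARD('k) - 1) m \<noteq> c" for m
    using False finite_field_card_gt_1[where 'k='k] by (auto simp: residue_def)
  then show ?thesis
    by simp
next
  case True
  let ?k = "CARD('k) - 1"
  let ?P = "PiE (UNIV :: 'n set) (\<lambda>_. - {0::'k})"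
  let ?f = "Poly_Mapping.lookup f"
  \<comment> \<open>The sum over the torus factors into one power sum per coordinate, each -1 or
    0.\<close>
  have orth: "(\<Sum>x\<in>?P. \<Prod>j\<in>UNIV. x j ^ (residue v ?k m j + (?k - c j))) =
      (if residue v ?k m = c then (-1) ^ CARD('n) else 0)" for m
  proof -
    have "(\<Sum>x\<in>?P. \<Prod>j\<in>UNIV. x j ^ (residue v ?k m j + (?k - c j))) =
        (\<Prod>j\<in>UNIV. \<Sum>x\<in>- {0::'k}. x ^ (residue v ?k m j + (?k - c j)))"
      by (rule prod_sum_PiE[symmetric]) auto
    also have "\<dots> = (\<Prod>j\<in>(UNIV::'n set). if ?k dvd residue v ?k m j + (?k - c j) then -1 else (0::'k))"
      by (simp only: finite_field_sum_powers)
    also have "\<dots> = (if residue v ?k m = c then (-1) ^ CARD('n) else 0)"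
      using True by (subst residue_eq_iff) auto
    finally show ?thesis .
  qed
  \<comment> \<open>Average the values of \<open>f\<close>, all 0, against the inverse character of
    \<open>c\<close>; swapping the sums then isolates the coefficients of class \<open>c\<close>, up
    to the nonzero sign \<open>(-1) ^ n\<close>.\<close>
  have "0 = (\<Sum>x\<in>?P. poly_eval (\<lambda>c. c) (\<lambda>i. \<Prod>j\<in>UNIV. x j ^ v i j) f * (\<Prod>j\<in>UNIV. x j ^ (?k - c j)))"
    using f by (intro sum.neutral[symmetric])
      (auto simp: vanishing_ideal_def affine_toric_set_def PiE_def Pi_def)
  also have "\<dots> = (\<Sum>x\<in>?P. (\<Sum>m\<in>Poly_Mapping.keys f.
      ?f m * (\<Prod>j\<in>UNIV. x j ^ residue v ?k m j)) * (\<Prod>j\<in>UNIV. x j ^ (?k - c j)))"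
    by (intro sum.cong refl arg_cong2[where f = "(*)"] poly_eval_parametrization) auto
  also have "\<dots> = (\<Sum>x\<in>?P. \<Sum>m\<in>Poly_Mapping.keys f.
      ?f m * (\<Prod>j\<in>UNIV. x j ^ (residue v ?k m j + (?k - c j))))"
    by (simp only: sum_distrib_right power_add prod.distrib mult.assoc)
  also have "\<dots> = (\<Sum>m\<in>Poly_Mapping.keys f. \<Sum>x\<in>?P.
      ?f m * (\<Prod>j\<in>UNIV. x j ^ (residue v ?k m j + (?k - c j))))"
    by (rule sum.swap)
  also have "\<dots> = (\<Sum>m\<in>Poly_Mapping.keys f.
      ?f m * (\<Sum>x\<in>?P. \<Prod>j\<in>UNIV. x j ^ (residue v ?k m j + (?k - c j))))"
    by (simp only: sum_distrib_left)
  also have "\<dots> = (-1) ^ CARD('n) * (\<Sum>m | m \<in> Poly_Mapping.keys f \<and> residue v ?k m = c. ?f m)"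
    unfolding orth by (simp add: sum_distrib_left sum.If_cases Int_def mult_ac if_distrib cong: if_cong)
  finally show ?thesis
    by simp
qed

text \<open>Grouping by residue and using additivity of \<open>h c\<close> leaves only class sums,
  which are 0. It is applied with \<open>h\<close> attaching coefficients to
  \<open>y\<close>-monomials in \<open>B\<close> and to class representatives in
  \<open>S\<close>.\<close>

lemma vanishing_sum_eq_0:
  fixes v :: "'s::finite \<Rightarrow> 'n::finite \<Rightarrow> nat" and f :: "('s, 'k::{field,finite}) mpoly"
    and h :: "('n \<Rightarrow> nat) \<Rightarrow> 'k \<Rightarrow> 'a::comm_monoid_add"
  assumes f: "f \<in> vanishing_ideal (affine_toric_set v)"
    and h0: "\<And>c. h c 0 = 0" and h_add: "\<And>c a b. h c (a + b) = h c a + h c b"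
  shows "(\<Sum>m\<in>Poly_Mapping.keys f. h (residue v (CARD('k) - 1) m) (Poly_Mapping.lookup f m)) = 0"
    (is "sum ?g ?K = 0")
proof -
  let ?r = "residue v (CARD('k) - 1)"
  have "sum ?g ?K = (\<Sum>c\<in>?r ` ?K. \<Sum>m | m \<in> ?K \<and> ?r m = c. ?g m)"
    by (rule sum.image_gen) simp
  also have "\<dots> = (\<Sum>c\<in>?r ` ?K. \<Sum>m | m \<in> ?K \<and> ?r m = c. h c (Poly_Mapping.lookup f m))"
    by (intro sum.cong) auto
  also have "\<dots> = (\<Sum>c\<in>?r ` ?K. h c (\<Sum>m | m \<in> ?K \<and> ?r m = c. Poly_Mapping.lookup f m))"
    by (intro sum.cong refl sum_comp_morphism[of "h _" "Poly_Mapping.lookup f", unfolded comp_def] h0 h_add)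
  finally show ?thesis
    by (simp add: vanishing_class_sum[OF f] h0)
qed

section \<open>The toric ideal\<close>

lemma Const_0: "Const 0 = 0"
  by (simp add: Const_def)

lemma Const_add: "Const (a + b) = Const a + Const b"
  by (simp add: Const_def single_add)

text \<open>The generators \<open>t_i - y^{v_i}\<close> turn \<open>t^m\<close> into a
  \<open>y\<close>-monomial, and \<open>y_j^(q-1) - 1\<close> reduces its exponents modulo
  \<open>q - 1\<close>.\<close>

lemma toric_gens_cong_monomial:
  fixes v :: "'s::finite \<Rightarrow> 'n::finite \<Rightarrow> nat" and q :: nat
  defines "J \<equiv> ideal_gen (toric_gens v q :: ('s + 'n, 'k::comm_ring_1) mpoly set)"
  shows "(\<Prod>i\<in>UNIV. Var (Inl i) ^ Poly_Mapping.lookup m i) -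
    (\<Prod>j\<in>UNIV. Var (Inr j) ^ residue v (q - 1) m j) \<in> J" (is "?t - ?y \<in> J")
proof -
  let ?z = "\<Prod>j\<in>UNIV. (Var (Inr j) :: ('s + 'n, 'k) mpoly) ^
    (\<Sum>i\<in>UNIV. v i j * Poly_Mapping.lookup m i)"
  have "?t - (\<Prod>i\<in>UNIV. (\<Prod>j\<in>UNIV. Var (Inr j) ^ v i j) ^ Poly_Mapping.lookup m i) \<in> J"
    unfolding J_def
    by (intro ideal_gen_cong_prod ideal_gen_cong_power ideal_gen_base) (auto simp: toric_gens_def)
  then have "?t - ?z \<in> J"
    by (simp only: prod_parametrization_power)
  moreover have "?z - ?y \<in> J"
    unfolding J_def residue_def
    by (intro ideal_gen_cong_prod ideal_gen_cong_power_mod ideal_gen_base) (auto simp: toric_gens_def)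
  ultimately have "(?t - ?z) + (?z - ?y) \<in> J"
    unfolding J_def by (rule ideal_gen_add)
  then show ?thesis
    by simp
qed

lemma incl_S_vanishing_ideal_subset:
  fixes v :: "'s::finite \<Rightarrow> 'n::finite \<Rightarrow> nat" and f :: "('s, 'k::{field,finite}) mpoly"
  assumes "f \<in> vanishing_ideal (affine_toric_set v)"
  shows "(incl_S f :: ('s + 'n, 'k) mpoly) \<in> ideal_gen (toric_gens v CARD('k))"
proof -
  let ?f = "Poly_Mapping.lookup f"
  let ?t = "\<lambda>m. \<Prod>i\<in>UNIV. (Var (Inl i) :: ('s + 'n, 'k) mpoly) ^ Poly_Mapping.lookup m i"
  let ?y = "\<lambda>c. \<Prod>j\<in>UNIV. (Var (Inr j) :: ('s + 'n, 'k) mpoly) ^ c j"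
  let ?r = "residue v (CARD('k) - 1)"
  \<comment> \<open>The image of \<open>f\<close> under \<open>t^m \<mapsto> y^residue\<close> is 0,
    so it may be subtracted from \<open>incl_S f\<close> term by term.\<close>
  have "(\<Sum>m\<in>Poly_Mapping.keys f. Const (?f m) * ?y (?r m)) = 0"
    using vanishing_sum_eq_0[OF assms, of "\<lambda>c a. Const a * ?y c"]
    by (simp add: Const_0 Const_add distrib_right)
  then have "incl_S f = (\<Sum>m\<in>Poly_Mapping.keys f. Const (?f m) * (?t m - ?y (?r m)))"
    by (simp add: incl_S_def poly_eval_prod_UNIV right_diff_distrib sum_subtractf)
  also have "\<dots> \<in> ideal_gen (toric_gens v CARD('k))"
    by (intro ideal_gen_sum ideal_gen_mult toric_gens_cong_monomial)
  finally show ?thesis .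
qed

lemma vanishing_ideal_if_incl_S:
  fixes v :: "'s::finite \<Rightarrow> 'n::finite \<Rightarrow> nat" and f :: "('s, 'k::{field,finite}) mpoly"
  assumes "(incl_S f :: ('s + 'n, 'k) mpoly) \<in> ideal_gen (toric_gens v CARD('k))"
  shows "f \<in> vanishing_ideal (affine_toric_set v)"
proof -
  have "poly_eval (\<lambda>c. c) (\<lambda>i. \<Prod>j\<in>UNIV. x j ^ v i j) f = 0" if x: "\<And>j. x j \<noteq> 0" for x
  proof -
    let ?p = "case_sum (\<lambda>i. \<Prod>j\<in>UNIV. x j ^ v i j) x"
    \<comment> \<open>At \<open>?p\<close>, \<open>t_i\<close> takes the value of
      \<open>y^{v_i}\<close>, and \<open>x j ^ (q - 1) = 1\<close> since \<open>x j\<close> is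
      nonzero.\<close>
    have "toric_gens v CARD('k) \<subseteq> vanishing_ideal {?p}"
      using x by (auto simp: toric_gens_def vanishing_ideal_def poly_eval_diff poly_eval_prod
          poly_eval_power finite_field_power_card_minus_1)
    then have "incl_S f \<in> vanishing_ideal {?p}"
      using ideal_gen_subset_vanishing_ideal assms by blast
    then show ?thesis
      by (simp add: vanishing_ideal_def poly_eval_incl_S)
  qed
  then show ?thesis
    by (auto simp: vanishing_ideal_def affine_toric_set_def)
qed

text \<open>Differences of monomials of equal residue generate: replacing each monomial of
  \<open>f\<close> by a fixed representative of its class gives 0.\<close>

lemma binomial_ideal_vanishing_ideal:
  fixes v :: "'s::finite \<Rightarrow> 'n::finite \<Rightarrow> nat"
  shows "binomial_ideal (vanishing_ideal (affine_toric_set v :: ('s \<Rightarrow> 'k::{field,finite}) set))"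
proof -
  let ?r = "residue v (CARD('k) - 1)"
  let ?I = "vanishing_ideal (affine_toric_set v) :: ('s, 'k) mpoly set"
  define G :: "('s, 'k) mpoly set" where "G = {monomial a - monomial b | a b. ?r a = ?r b}"
  \<comment> \<open>The choice is meaningful only for residues that occur, and \<open>rep\<close> is
    only applied to those.\<close>
  define rep where "rep c = (SOME m. ?r m = c)" for c
  have rep: "?r (rep (?r m)) = ?r m" for m
    unfolding rep_def by (rule someI) simp
  have "G \<subseteq> ?I"
    by (auto simp: G_def monomial_def vanishing_ideal_def affine_toric_set_def poly_eval_diff
        poly_eval_single_parametrization)
  then have "ideal_gen G \<subseteq> ?I"
    by (rule ideal_gen_subset_vanishing_ideal)
  moreover have "?I \<subseteq> ideal_gen G"
  proof
    fix f assume f: "f \<in> ?I"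
    let ?f = "Poly_Mapping.lookup f"
    let ?s = Poly_Mapping.single
    have "(\<Sum>m\<in>Poly_Mapping.keys f. ?s (rep (?r m)) (?f m)) = 0"
      using vanishing_sum_eq_0[OF f, of "\<lambda>c. ?s (rep c)"] by (simp add: single_add)
    then have "f = (\<Sum>m\<in>Poly_Mapping.keys f. ?s m (?f m) - ?s (rep (?r m)) (?f m))"
      by (simp add: sum_subtractf poly_mapping_sum_single)
    also have "\<dots> = (\<Sum>m\<in>Poly_Mapping.keys f. Const (?f m) * (monomial m - monomial (rep (?r m))))"
      by (simp add: Const_def monomial_def right_diff_distrib mult_single)
    also have "\<dots> \<in> ideal_gen G"
      by (intro ideal_gen_sum ideal_gen_mult ideal_gen_base) (use rep in \<open>force simp: G_def\<close>)
    finally show "f \<in> ideal_gen G" .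
  qed
  moreover have "\<forall>g\<in>G. is_binomial g"
    by (auto simp: G_def is_binomial_def)
  ultimately show ?thesis
    unfolding binomial_ideal_def by blast
qed

theorem theorem3p4:
  fixes v :: "'s::finite \<Rightarrow> 'n::finite \<Rightarrow> nat"
    and X :: "('s \<Rightarrow> 'k::{field,finite}) set"
    and q :: nat
  assumes "q = CARD('k)"
    and "X = affine_toric_set v"
  shows "incl_S ` vanishing_ideal X =
           ideal_gen (toric_gens v q :: ('s + 'n, 'k) mpoly set)
           \<inter> range (incl_S :: ('s, 'k) mpoly \<Rightarrow> ('s + 'n, 'k) mpoly)
         \<and> binomial_ideal (vanishing_ideal X)"
  unfolding assms
  \<comment> \<open>An element of the intersection has the form \<open>incl_S f\<close>, and the
    converse inclusion lemma places this \<open>f\<close> in the vanishing ideal.\<close>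
  using incl_S_vanishing_ideal_subset vanishing_ideal_if_incl_S binomial_ideal_vanishing_ideal
  by blast

end
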